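(* Let $N:=m^{[\frac{d+1}{2}]}$ and $U\in C\ell^{\frac1m}_d$. For the characteristic polynomial coefficients $C_{(k)}=C_{(k)}(U)\in\mathbb{C}$, $k=1,2,\dots,N$, of $U$, defined by $$\varphi_U(\lambda):={\rm Det}(\lambda e-U)=\lambda^N-C_{(1)}\lambda^{N-1}-\cdots-C_{(N)},\qquad\lambda\in\mathbb{C},$$ we have the following basis-free formulas: $$U_{(1)}:=U,\qquad U_{(k+1)}=U(U_{(k)}-C_{(k)}),\qquad C_{(k)}=\frac{N}{k}\langle U_{(k)}\rangle_0,$$ $${\rm Det}(U)=-U_{(N)}=-C_{(N)}=U(C_{(N-1)}-U_{(N-1)})\in\mathbb{C}.$$
   Context: The generalized (complex) Clifford algebra $C\ell^{\frac1m}_d$ is the unital associative algebra over $\mathbb{C}$ with identity $e$ and generators $e_1,\dots,e_d$ subject to $e_j^m=e$ for $j=1,\dots,d$ and $e_ke_l=\omega e_le_k$ for $k<l$, where $\omega:=e^{2\pi i/m}$. It has dimension $m^d$ with basis $e_1^{j_1}\cdots e_d^{j_d}$, $0\le j_1,\dots,j_d\le m-1$, so each element is uniquely $U=\sum u_{j_1\ldots j_d}e_1^{j_1}\cdots e_d^{j_d}$ with $u_{j_1\ldots j_d}\in\mathbb{C}$. Scalars $c\in\mathbb{C}$ are identified with $ce$. The projection onto grade $0$ is $\langle U\rangle_0:=u_{0\ldots0}e\equiv u_{0\ldots0}\in\mathbb{C}$. Here $[\cdot]$ denotes the integer part. Determinant: ${\rm Det}(U):=\det(\gamma(U))\in\mathbb{C}$,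 where $\gamma$ is any faithful matrix representation of minimal dimension, i.e. any isomorphism of unital complex algebras from $C\ell^{\frac1m}_d$ onto ${\rm Mat}(m^{\frac d2},\mathbb{C})$ if $d$ is even, and onto the direct sum of $m$ copies of ${\rm Mat}(m^{\frac{d-1}2},\mathbb{C})$, regarded as block-diagonal matrices of size $m^{\frac{d+1}{2}}$, if $d$ is odd. In both cases the matrices have size $N$; ${\rm Det}$ does not depend on the choice of $\gamma$.
   Formalization: The printed Det(U) = -U_(N) fails for odd N (m=3, d=1, U=e: Det(U)=1, C_(3)=1); it is corrected to Det(U) = (-1)^N(-U_(N)), which is the printed formula for even N; the last equality, with U_(N-1) and C_(N-1), is stated for N ≥ 2, where they exist. *)

theory Defs
  imports Complex_Main "HOL-Library.FuncSet" "Jordan_Normal_Form.Determinant"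
begin

definition gc_root :: "nat \<Rightarrow> complex" where
  "gc_root m = exp (2 * complex_of_real pi * \<i> / of_nat m)"

(* Exponent tuples (j_1, ..., j_d) with 0 <= j_i <= m - 1, as extensional functions. *)
definition gc_index :: "nat \<Rightarrow> nat \<Rightarrow> (nat \<Rightarrow> nat) set" where
  "gc_index m d = {1..d} \<rightarrow>\<^sub>E {..<m}"

(* The ordered product e_1^{j_1} ... e_d^{j_d}. *)
definition gc_monomial :: "nat \<Rightarrow> (nat \<Rightarrow> 'a::ring_1) \<Rightarrow> (nat \<Rightarrow> nat) \<Rightarrow> 'a" where
  "gc_monomial d e J = prod_list (map (\<lambda>i. e i ^ J i) [1..<Suc d])"

(* A type of class ring_1 with a complex scalar multiplication is the generalized Clifford
   algebra with generators e 1, ..., e d: a unital associative complex algebra in which the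
   defining relations hold and whose monomials e_1^{j_1} ... e_d^{j_d} form a basis. The basis
   property (so dimension m^d) says that the algebra is generated by the e j and that no further
   relations hold. The identity e of the algebra is 1. *)
locale generalized_clifford_algebra =
  vector_space scale
  for scale :: "complex \<Rightarrow> 'a::ring_1 \<Rightarrow> 'a" (infixr "*s" 75) +
  fixes m d :: nat
    and e :: "nat \<Rightarrow> 'a"
  assumes m_pos: "m \<ge> 1"
    and scale_mult_left: "\<And>c x y. (c *s x) * y = c *s (x * y)"
    and scale_mult_right: "\<And>c x y. x * (c *s y) = c *s (x * y)"
    and generator_power: "\<And>j. j \<in> {1..d} \<Longrightarrow> e j ^ m = 1"
    and generator_commute:
      "\<And>k l. \<lbrakk>k \<in> {1..d}; l \<in> {1..d}; k < l\<rbrakk> \<Longrightarrow> e k * e l = gc_root m *s (e l * e k)"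
    and monomial_basis:
      "\<And>U. \<exists>!u. u \<in> gc_index m d \<rightarrow>\<^sub>E (UNIV :: complex set) \<and>
              U = (\<Sum>J\<in>gc_index m d. u J *s gc_monomial d e J)"

definition gc_coeffs ::
  "(complex \<Rightarrow> 'a::ring_1 \<Rightarrow> 'a) \<Rightarrow> nat \<Rightarrow> nat \<Rightarrow> (nat \<Rightarrow> 'a) \<Rightarrow> 'a \<Rightarrow> (nat \<Rightarrow> nat) \<Rightarrow> complex" where
  "gc_coeffs scale m d e U =
     (THE u. u \<in> gc_index m d \<rightarrow>\<^sub>E (UNIV :: complex set) \<and>
             U = (\<Sum>J\<in>gc_index m d. scale (u J) (gc_monomial d e J)))"

(* The grade-0 projection, with values in the complex numbers. *)
definition gc_grade0 ::
  "(complex \<Rightarrow> 'a::ring_1 \<Rightarrow> 'a) \<Rightarrow> nat \<Rightarrow> nat \<Rightarrow> (nat \<Rightarrow> 'a) \<Rightarrow> 'a \<Rightarrow> complex" where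
  "gc_grade0 scale m d e U = gc_coeffs scale m d e U (\<lambda>i\<in>{1..d}. 0)"

(* Mat(m^{d/2}) for even d; for odd d the direct sum of m copies of Mat(m^{(d-1)/2}), realized as
   block-diagonal matrices. *)
definition gc_matrix_algebra :: "nat \<Rightarrow> nat \<Rightarrow> complex mat set" where
  "gc_matrix_algebra m d =
     (if even d then carrier_mat (m ^ (d div 2)) (m ^ (d div 2))
      else {diag_block_mat As | As.
              length As = m \<and>
              set As \<subseteq> carrier_mat (m ^ ((d - 1) div 2)) (m ^ ((d - 1) div 2))})"

(* Isomorphisms of unital complex algebras onto the matrix algebra above, i.e. faithful matrix
   representations of minimal dimension. *)
definition gc_minimal_rep ::
  "(complex \<Rightarrow> 'a::ring_1 \<Rightarrow> 'a) \<Rightarrow> nat \<Rightarrow> nat \<Rightarrow> ('a \<Rightarrow> complex mat) \<Rightarrow> bool" where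
  "gc_minimal_rep scale m d \<gamma> \<longleftrightarrow>
     bij_betw \<gamma> UNIV (gc_matrix_algebra m d) \<and>
     (\<forall>x y. \<gamma> (x + y) = \<gamma> x + \<gamma> y) \<and>
     (\<forall>c x. \<gamma> (scale c x) = c \<cdot>\<^sub>m \<gamma> x) \<and>
     (\<forall>x y. \<gamma> (x * y) = \<gamma> x * \<gamma> y) \<and>
     \<gamma> 1 = 1\<^sub>m (m ^ ((d + 1) div 2))"

definition gc_Det :: "('a \<Rightarrow> complex mat) \<Rightarrow> 'a \<Rightarrow> complex" where
  "gc_Det \<gamma> U = det (\<gamma> U)"

definition gc_char_poly ::
  "(complex \<Rightarrow> 'a::ring_1 \<Rightarrow> 'a) \<Rightarrow> ('a \<Rightarrow> complex mat) \<Rightarrow> 'a \<Rightarrow> complex \<Rightarrow> complex" where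
  "gc_char_poly scale \<gamma> U t = gc_Det \<gamma> (scale t 1 - U)"

(* The coefficients C_(1), ..., C_(N) in phi(t) = t^N - C_(1) t^(N-1) - ... - C_(N).
   Sign pitfall: for phi(t) = Det(t e - U), t = 0 gives (-1)^N Det(U) = - C_(N), which is
   Det(U) = - C_(N) exactly when N is even or Det(U) = 0. *)
definition char_coeffs :: "nat \<Rightarrow> (complex \<Rightarrow> complex) \<Rightarrow> nat \<Rightarrow> complex" where
  "char_coeffs N \<phi> =
     (THE C. C \<in> {1..N} \<rightarrow>\<^sub>E (UNIV :: complex set) \<and>
             (\<forall>t. \<phi> t = t ^ N - (\<Sum>k=1..N. C k * t ^ (N - k))))"

end

theory Submission
  imports Defs "Jordan_Normal_Form.Char_Poly"
begin

text \<open>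
  Let \<open>A = \<gamma> U\<close> with characteristic polynomial \<open>p\<close>, and expand the adjugate of \<open>t - A\<close> in powers
  of \<open>t\<close>. Comparing coefficients in \<open>(t - A) adj(t - A) = p(t)\<close> shows that the coefficient matrices
  satisfy the recursion of the \<open>U\<^sub>(\<^sub>k\<^sub>) - C\<^sub>(\<^sub>k\<^sub>)\<close>, and that it ends with \<open>U\<^sub>(\<^sub>N\<^sub>) = C\<^sub>(\<^sub>N\<^sub>)\<close>;
  since the trace of \<open>adj(t - A)\<close> is \<open>p'(t)\<close>, the trace of \<open>\<gamma> U\<^sub>(\<^sub>k\<^sub>)\<close> is \<open>k C\<^sub>(\<^sub>k\<^sub>)\<close>.

  It remains to see that \<open>\<gamma> U\<close> has trace \<open>N \<langle>U\<rangle>\<^sub>0\<close>. Both sides are multiples of the trace of the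
  left multiplication by \<open>U\<close>: in the monomial basis this trace is \<open>m\<^sup>d \<langle>U\<rangle>\<^sub>0\<close>, because
  multiplication by a monomial other than \<open>1\<close> permutes the basis up to scalars without fixed points;
  in the basis of matrix units it is \<open>n\<close> times the trace of \<open>\<gamma> U\<close>, where \<open>n\<close> is the block size
  and \<open>n N = m\<^sup>d\<close>.
\<close>

section \<open>Block-diagonal matrices described entrywise\<close>

text \<open>Index \<open>i\<close> lies in block \<open>i div n\<close>, so being block-diagonal
  becomes a vanishing condition on entries, which is easier to use than a list of blocks. The
  induction peels off the first block; behind it, block numbers drop by one.\<close>

lemma diag_block_mat_iff:
  fixes M :: "'a::zero mat"
  assumes n: "n > 0"
  shows "(\<exists>As. M = diag_block_mat As \<and> length As = k \<and> set As \<subseteq> carrier_mat n n) \<longleftrightarrow>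
    M \<in> carrier_mat (k * n) (k * n) \<and>
    (\<forall>i<k * n. \<forall>j<k * n. i div n \<noteq> j div n \<longrightarrow> M $$ (i, j) = 0)"
    (is "?L k M \<longleftrightarrow> ?R k M")
proof (induction k arbitrary: M)
  case 0
  show ?case by (auto intro!: eq_matI)
next
  case (Suc k)
  let ?F = "\<lambda>A B :: 'a mat. four_block_mat A (0\<^sub>m n (k * n)) (0\<^sub>m (k * n) n) B"
  have shift: "i div n = Suc ((i - n) div n)" if "\<not> i < n" for i
    using that n by (simp add: div_if)
  show ?case
  proof
    assume "?L (Suc k) M"
    then obtain A As where M: "M = diag_block_mat (A # As)" and len: "length As = k"
      and A: "A \<in> carrier_mat n n" and As: "set As \<subseteq> carrier_mat n n"
      by (auto simp: length_Suc_conv)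
    let ?B = "diag_block_mat As"
    have B: "?R k ?B" using Suc.IH[of ?B] len As by blast
    have MF: "M = ?F A ?B" using A B unfolding M by (auto simp: Let_def)
    have "M $$ (i, j) = 0" if "i < Suc k * n" "j < Suc k * n" "i div n \<noteq> j div n" for i j
    proof -
      have "i < n \<Longrightarrow> \<not> j < n" using that by auto
      then show ?thesis using that A B unfolding MF by (auto simp: shift)
    qed
    then show "?R (Suc k) M" using A B unfolding MF by (auto simp: four_block_carrier_mat)
  next
    assume R: "?R (Suc k) M"
    define A where "A = mat n n (\<lambda>ij. M $$ ij)"
    define B where "B = mat (k * n) (k * n) (\<lambda>(i, j). M $$ (i + n, j + n))"
    have "?R k B" using R n by (auto simp: B_def)
    then obtain As where As: "B = diag_block_mat As" "length As = k" "set As \<subseteq> carrier_mat n n"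
      using Suc.IH[of B] by blast
    \<comment> \<open>One index lies in block 0 and the other in a later block, so both rectangles
      beside the first block vanish.\<close>
    have z: "M $$ (i, j) = 0" if "i < n + k * n" "j < n + k * n" "i < n \<longleftrightarrow> \<not> j < n" for i j
    proof -
      have "i div n \<noteq> j div n" using that by (cases "i < n") (auto simp: shift)
      then show ?thesis using R that by simp
    qed
    have "M = ?F A B"
      using R by (intro eq_matI) (auto simp: A_def B_def z)
    also have "\<dots> = diag_block_mat (A # As)"
      by (simp add: Let_def As(1)[symmetric]) (simp add: A_def B_def)
    finally show "?L (Suc k) M" using As by (intro exI[of _ "A # As"]) (auto simp: A_def)
  qed
qed

section \<open>Coefficients of the adjugate of t - A\<close>

lemma poly_char_poly:
  assumes "A \<in> carrier_mat n n"
  shows "poly (char_poly A) t = det (t \<cdot>\<^sub>m 1\<^sub>m n - A)"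
  unfolding char_poly_def
  by (rule poly_det_cong[of _ n]) (use assms in \<open>auto simp: char_poly_matrix_def\<close>)

text \<open>These are the matrices of the Faddeev-LeVerrier algorithm: adj(t - A) is the sum of the
  t^k \<open>adj_coeff_mat A k\<close>. As scalar matrices they can be compared with images under
  \<gamma>.\<close>

definition adj_coeff_mat :: "'a::comm_ring_1 mat \<Rightarrow> nat \<Rightarrow> 'a mat" where
  "adj_coeff_mat A k =
     mat (dim_row A) (dim_row A) (\<lambda>ij. coeff (adj_mat (char_poly_matrix A) $$ ij) k)"

lemma dim_adj_coeff_mat [simp]:
  "dim_row (adj_coeff_mat A k) = dim_row A" "dim_col (adj_coeff_mat A k) = dim_row A"
  by (simp_all add: adj_coeff_mat_def)

lemma adj_coeff_mat_carrier [simp]: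
  "A \<in> carrier_mat n n \<Longrightarrow> adj_coeff_mat A k \<in> carrier_mat n n"
  by (auto simp: adj_coeff_mat_def)

text \<open>This is one entry of (t - A) adj(t - A) = p(t), solved for t adj(t - A). Writing
  multiplication by t as \<open>pCons 0\<close> turns taking coefficients into an index
  shift.\<close>

lemma char_poly_adj_entry:
  assumes A: "A \<in> carrier_mat n n" and ij: "i < n" "j < n"
  shows "pCons 0 (adj_mat (char_poly_matrix A) $$ (i, j)) =
    (\<Sum>l<n. smult (A $$ (i, l)) (adj_mat (char_poly_matrix A) $$ (l, j))) +
    (if i = j then char_poly A else 0)"
proof -
  let ?X = "char_poly_matrix A"
  let ?R = "adj_mat ?X"
  have X: "?X \<in> carrier_mat n n" using A by simp
  note R = adj_mat[OF X]
  have "(if i = j then char_poly A else 0) = (?X * ?R) $$ (i, j)"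
    using R(2) ij by (simp add: char_poly_def)
  also have "\<dots> = (\<Sum>l<n. ?X $$ (i, l) * ?R $$ (l, j))"
    using X R(1) ij by (auto simp: scalar_prod_def atLeast0LessThan intro!: sum.cong)
  also have "\<dots> = (\<Sum>l<n. (if l = i then pCons 0 (?R $$ (i, j)) else 0)
      - smult (A $$ (i, l)) (?R $$ (l, j)))"
    using A ij by (intro sum.cong) (auto simp: char_poly_matrix_def algebra_simps)
  also have "\<dots> = pCons 0 (?R $$ (i, j)) - (\<Sum>l<n. smult (A $$ (i, l)) (?R $$ (l, j)))"
    using ij by (simp add: sum_subtractf)
  finally show ?thesis by (simp add: algebra_simps)
qed

text \<open>Compare the coefficients of t^(k+1) and of t^0 in \<open>char_poly_adj_entry\<close>;
  multiplication by t leaves no constant term, which is what ends the recursion.\<close>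

lemma
  assumes A: "A \<in> carrier_mat n n"
  shows adj_coeff_mat_Suc:
      "adj_coeff_mat A k = A * adj_coeff_mat A (Suc k) + coeff (char_poly A) (Suc k) \<cdot>\<^sub>m 1\<^sub>m n"
    and adj_coeff_mat_0:
      "A * adj_coeff_mat A 0 + coeff (char_poly A) 0 \<cdot>\<^sub>m 1\<^sub>m n = 0\<^sub>m n n"
proof -
  have entry: "(A * adj_coeff_mat A k + coeff (char_poly A) k \<cdot>\<^sub>m 1\<^sub>m n) $$ (i, j) =
      coeff (pCons 0 (adj_mat (char_poly_matrix A) $$ (i, j))) k" if "i < n" "j < n" for i j k
    unfolding char_poly_adj_entry[OF A that]
    using A that by (auto simp: adj_coeff_mat_def scalar_prod_def coeff_sum atLeast0LessThan)
  have lhs: "adj_coeff_mat A k $$ (i, j) = coeff (adj_mat (char_poly_matrix A) $$ (i, j)) k"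
    if "i < n" "j < n" for i j k
    using A that by (auto simp: adj_coeff_mat_def)
  show "adj_coeff_mat A k = A * adj_coeff_mat A (Suc k) + coeff (char_poly A) (Suc k) \<cdot>\<^sub>m 1\<^sub>m n"
    by (rule eq_matI) (use A in \<open>auto simp: entry lhs simp del: index_add_mat(1)\<close>)
  show "A * adj_coeff_mat A 0 + coeff (char_poly A) 0 \<cdot>\<^sub>m 1\<^sub>m n = 0\<^sub>m n n"
    by (rule eq_matI) (use A in \<open>auto simp: entry simp del: index_add_mat(1)\<close>)
qed

text \<open>No degree bound for cofactors is computed. The coefficients vanish beyond the largest
  degree that occurs, and the recursion carries this down to \<open>n\<close>, since p has no
  coefficients above degree \<open>n\<close>.\<close>

lemma adj_coeff_mat_eq_0:
  assumes A: "A \<in> carrier_mat n n" and k: "n \<le> k"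
  shows "adj_coeff_mat A k = 0\<^sub>m n n"
proof -
  let ?R = "adj_mat (char_poly_matrix A)"
  \<comment> \<open>Inserting 0 keeps the set nonempty when \<open>n = 0\<close>.\<close>
  let ?K = "Suc (Max (insert 0 ((\<lambda>ij. degree (?R $$ ij)) ` ({..<n} \<times> {..<n}))))"
  have high: "adj_coeff_mat A k = 0\<^sub>m n n" if "k \<ge> ?K" for k
    using A that by (intro eq_matI) (auto simp: adj_coeff_mat_def Suc_le_eq intro!: coeff_eq_0)
  have deg: "coeff (char_poly A) (Suc k) = 0" if "n \<le> k" for k
    using degree_monic_char_poly[OF A] that by (intro coeff_eq_0) auto
  have "k \<le> max ?K k" by simp
  then show ?thesis using k
  proof (induction k rule: inc_induct)
    case base
    show ?case by (rule high) simp
  next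
    case (step l)
    have z: "adj_coeff_mat A (Suc l) = 0\<^sub>m n n" using step by simp
    have "adj_coeff_mat A l = A * 0\<^sub>m n n + 0 \<cdot>\<^sub>m 1\<^sub>m n"
      unfolding adj_coeff_mat_Suc[OF A, of l] z deg[OF step.prems] ..
    also have "\<dots> = 0\<^sub>m n n" using A by (intro eq_matI) auto
    finally show ?case .
  qed
qed

lemma adj_coeff_mat_top:
  assumes A: "A \<in> carrier_mat n n" and n: "n > 0"
  shows "adj_coeff_mat A (n - 1) = 1\<^sub>m n"
proof -
  have "adj_coeff_mat A (n - 1) = A * 0\<^sub>m n n + 1 \<cdot>\<^sub>m 1\<^sub>m n"
    unfolding adj_coeff_mat_Suc[OF A, of "n - 1"]
    using n degree_monic_char_poly[OF A] by (simp add: adj_coeff_mat_eq_0[OF A])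
  also have "\<dots> = 1\<^sub>m n" using A by (intro eq_matI) auto
  finally show ?thesis .
qed

text \<open>The diagonal cofactors of t - A are the characteristic polynomials of the principal
  submatrices of A, and these sum to p'(t).\<close>

lemma trace_adj_coeff_mat:
  fixes A :: "'a::idom mat"
  assumes A: "A \<in> carrier_mat n n"
  shows "(\<Sum>i<n. adj_coeff_mat A k $$ (i, i)) = of_nat (Suc k) * coeff (char_poly A) (Suc k)"
proof -
  have "adj_mat (char_poly_matrix A) $$ (i, i) = char_poly (mat_delete A i i)" if i: "i < n" for i
  proof -
    have "mat_delete (char_poly_matrix A) i i = char_poly_matrix (mat_delete A i i)"
      using A i by (intro eq_matI) (auto simp: mat_delete_def char_poly_matrix_def)
    then show ?thesis using A i
      by (simp add: adj_mat_def cofactor_def char_poly_def char_poly_matrix_def)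
  qed
  then have "(\<Sum>i<n. adj_coeff_mat A k $$ (i, i)) = coeff (\<Sum>i<n. char_poly (mat_delete A i i)) k"
    using A by (auto simp: adj_coeff_mat_def coeff_sum intro!: sum.cong)
  then show ?thesis by (simp add: pderiv_char_poly[OF A, symmetric] coeff_pderiv)
qed

section \<open>Independence of the trace from the basis\<close>

lemma (in vector_space) linear_functionalI:
  assumes "\<And>x y. f (x + y) = f x + f y" "\<And>c x. f (c *s x) = c * f x"
  shows "module_hom scale (*) f"
proof -
  have "Modules.module ((*) :: 'a \<Rightarrow> 'a \<Rightarrow> 'a)" by unfold_locales (simp_all add: algebra_simps)
  then show ?thesis using assms by (simp add: module_hom_iff module_axioms)
qed

text \<open>This is tr(PQ) = tr(QP): expanding \<open>f (b i)\<close> in the family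
  \<open>c\<close>, or \<open>c j\<close> in the family \<open>b\<close>, leads to the same double
  sum.\<close>

lemma (in vector_space) trace_basis_independent:
  assumes I: "finite I" "\<And>x. x = (\<Sum>i\<in>I. \<beta> i x *s b i)"
    and J: "finite J" "\<And>x. x = (\<Sum>j\<in>J. \<delta> j x *s c j)"
    and \<beta>: "\<And>i. i \<in> I \<Longrightarrow> module_hom scale (*) (\<beta> i)"
    and \<delta>: "\<And>j. j \<in> J \<Longrightarrow> module_hom scale (*) (\<delta> j)"
    and f: "module_hom scale scale f"
  shows "(\<Sum>i\<in>I. \<beta> i (f (b i))) = (\<Sum>j\<in>J. \<delta> j (f (c j)))"
proof -
  have "(\<Sum>i\<in>I. \<beta> i (f (b i))) = (\<Sum>i\<in>I. \<Sum>j\<in>J. \<delta> j (f (b i)) * \<beta> i (c j))"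
  proof (rule sum.cong[OF refl])
    fix i assume "i \<in> I"
    then interpret i: module_hom scale "(*)" "\<beta> i" by (rule \<beta>)
    show "\<beta> i (f (b i)) = (\<Sum>j\<in>J. \<delta> j (f (b i)) * \<beta> i (c j))"
      by (subst J(2)[of "f (b i)"]) (simp add: i.sum i.scale)
  qed
  also have "\<dots> = (\<Sum>j\<in>J. \<Sum>i\<in>I. \<delta> j (f (b i)) * \<beta> i (c j))"
    by (rule sum.swap)
  also have "\<dots> = (\<Sum>j\<in>J. \<delta> j (f (c j)))"
  proof (rule sum.cong[OF refl])
    fix j assume "j \<in> J"
    then interpret j: module_hom scale "(*)" "\<delta> j" by (rule \<delta>)
    interpret f: module_hom scale scale f by (rule f)
    have "\<delta> j (f (c j)) = (\<Sum>i\<in>I. \<beta> i (c j) * \<delta> j (f (b i)))"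
      by (subst I(2)[of "c j"]) (simp add: j.sum j.scale f.sum f.scale)
    then show "(\<Sum>i\<in>I. \<delta> j (f (b i)) * \<beta> i (c j)) = \<delta> j (f (c j))"
      by (simp add: mult.commute)
  qed
  finally show ?thesis .
qed

section \<open>Monomials and coordinates in the Clifford algebra\<close>

lemma finite_gc_index [simp]: "finite (gc_index m d)"
  by (simp add: gc_index_def finite_PiE)

lemma card_gc_index: "card (gc_index m d) = m ^ d"
  by (simp add: gc_index_def card_PiE)

lemma gc_monomial_Suc: "gc_monomial (Suc n) e J = gc_monomial n e J * e (Suc n) ^ J (Suc n)"
  by (simp add: gc_monomial_def)

lemma gc_monomial_cong:
  "(\<And>i. i \<in> {1..d} \<Longrightarrow> J i = K i) \<Longrightarrow> gc_monomial d e J = gc_monomial d e K"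
  unfolding gc_monomial_def
  by (intro arg_cong[where f = prod_list] map_cong) (auto simp del: upt_Suc)

lemma gc_monomial_restrict: "gc_monomial d e (restrict J {1..d}) = gc_monomial d e J"
  by (rule gc_monomial_cong) simp

lemma gc_monomial_0: "gc_monomial d e (\<lambda>i\<in>{1..d}. 0) = 1"
  unfolding gc_monomial_restrict
  by (induction d) (simp add: gc_monomial_def, simp add: gc_monomial_Suc)

context generalized_clifford_algebra
begin

abbreviation "cl_coeffs \<equiv> gc_coeffs scale m d e"

lemma coeffs_expansion: "U = (\<Sum>J\<in>gc_index m d. cl_coeffs U J *s gc_monomial d e J)"
  using theI'[OF monomial_basis[of U]] by (simp add: gc_coeffs_def)

text \<open>Uniqueness in \<open>monomial_basis\<close> concerns extensional functions only;
  restricting \<open>u\<close> once here lets later expansions use arbitrary coefficient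
  functions.\<close>

lemma coeffs_unique:
  assumes "U = (\<Sum>J\<in>gc_index m d. u J *s gc_monomial d e J)" and "J \<in> gc_index m d"
  shows "cl_coeffs U J = u J"
proof -
  have "cl_coeffs U = restrict u (gc_index m d)"
    unfolding gc_coeffs_def
    by (rule the1_equality[OF monomial_basis]) (use assms in auto)
  then show ?thesis using assms by simp
qed

lemma coeffs_scaled_monomial:
  assumes "K \<in> gc_index m d" "J \<in> gc_index m d"
  shows "cl_coeffs (c *s gc_monomial d e K) J = (if J = K then c else 0)"
proof (rule coeffs_unique[OF _ assms(2)])
  have "(\<Sum>J\<in>gc_index m d. (if J = K then c else 0) *s gc_monomial d e J) =
      (\<Sum>J\<in>gc_index m d. if J = K then c *s gc_monomial d e J else 0)"
    by (rule sum.cong) auto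
  then show "c *s gc_monomial d e K =
      (\<Sum>J\<in>gc_index m d. (if J = K then c else 0) *s gc_monomial d e J)"
    using assms by simp
qed

lemma coeffs_linear:
  assumes J: "J \<in> gc_index m d"
  shows "module_hom scale (*) (\<lambda>U. cl_coeffs U J)"
proof -
  have "cl_coeffs (x + y) J = cl_coeffs x J + cl_coeffs y J" for x y
  proof (rule coeffs_unique[OF _ J])
    show "x + y = (\<Sum>J\<in>gc_index m d. (cl_coeffs x J + cl_coeffs y J) *s gc_monomial d e J)"
      by (simp add: scale_left_distrib sum.distrib flip: coeffs_expansion)
  qed
  moreover have "cl_coeffs (c *s x) J = c * cl_coeffs x J" for c x
  proof (rule coeffs_unique[OF _ J])
    show "c *s x = (\<Sum>J\<in>gc_index m d. (c * cl_coeffs x J) *s gc_monomial d e J)"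
      by (simp flip: coeffs_expansion scale_scale scale_sum_right)
  qed
  ultimately show ?thesis by (rule linear_functionalI)
qed

text \<open>The scalars stay existential throughout: for the trace it only matters which monomial a
  product is proportional to.\<close>

lemma scalar_commute_mult:
  assumes "\<exists>c. x * y = c *s (y * x)" "\<exists>c. x * z = c *s (z * x)"
  shows "\<exists>c. x * (y * z) = c *s ((y * z) * x)"
proof -
  obtain a b where ab: "x * y = a *s (y * x)" "x * z = b *s (z * x)" using assms by blast
  have "x * (y * z) = (x * y) * z" by (simp add: mult.assoc)
  also have "\<dots> = a *s (y * (x * z))" by (simp add: ab(1) scale_mult_left mult.assoc)
  also have "\<dots> = (a * b) *s ((y * z) * x)"
    by (simp add: ab(2) scale_mult_right mult.assoc)
  finally show ?thesis ..
qed

lemma scalar_commute_power: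
  assumes "\<exists>c. x * y = c *s (y * x)"
  shows "\<exists>c. x * y ^ n = c *s (y ^ n * x)"
proof (induction n)
  case 0
  show ?case by (intro exI[of _ 1]) simp
next
  case (Suc n)
  then show ?case using scalar_commute_mult[OF assms Suc.IH] by simp
qed

lemma scalar_commute_power_left:
  assumes "\<exists>c. x * y = c *s (y * x)"
  shows "\<exists>c. x ^ n * y = c *s (y * x ^ n)"
proof -
  obtain c where c: "x * y = c *s (y * x)" using assms ..
  have "x ^ n * y = (c ^ n) *s (y * x ^ n)"
  proof (induction n)
    case (Suc n)
    have "x ^ Suc n * y = x * (x ^ n * y)" by (simp add: mult.assoc)
    also have "\<dots> = (c ^ n) *s ((x * y) * x ^ n)" by (simp add: Suc scale_mult_right mult.assoc)
    also have "\<dots> = (c ^ Suc n) *s (y * x ^ Suc n)"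
      by (simp add: c scale_mult_left mult.assoc mult.commute)
    finally show ?case .
  qed simp
  then show ?thesis ..
qed

lemma generator_commute_monomial:
  assumes "n < k" "k \<le> d"
  shows "\<exists>c. e k * gc_monomial n e J = c *s (gc_monomial n e J * e k)"
  using assms
proof (induction n)
  case 0
  show ?case by (intro exI[of _ 1]) (simp add: gc_monomial_def)
next
  case (Suc n)
  have "e (Suc n) * e k = gc_root m *s (e k * e (Suc n))"
    using Suc.prems by (intro generator_commute) auto
  \<comment> \<open>The defining relation orders the indices the other way, so the root of unity,
    nonzero as an exponential, is inverted.\<close>
  then have "e k * e (Suc n) = inverse (gc_root m) *s (e (Suc n) * e k)"
    by (simp add: gc_root_def)
  then show ?case
    unfolding gc_monomial_Suc using Suc by (intro scalar_commute_mult scalar_commute_power) auto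
qed

lemma generator_power_mod:
  assumes "k \<in> {1..d}"
  shows "e k ^ (a mod m) = e k ^ a"
proof -
  have "e k ^ a = e k ^ (m * (a div m) + a mod m)" by simp
  also have "\<dots> = e k ^ (a mod m)"
    unfolding power_add power_mult by (simp add: generator_power[OF assms])
  finally show ?thesis ..
qed

text \<open>Induction on the number of generators: the power of the last generator moves past the
  monomial in the earlier ones at the cost of a scalar, and exponents reduce mod \<open>m\<close>
  because \<open>e k ^ m = 1\<close>.\<close>

lemma monomial_mult:
  assumes "n \<le> d"
  shows "\<exists>c. gc_monomial n e K * gc_monomial n e J =
    c *s gc_monomial n e (\<lambda>i. (K i + J i) mod m)"
  using assms
proof (induction n)
  case 0
  show ?case by (intro exI[of _ 1]) (simp add: gc_monomial_def)
next
  case (Suc n)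
  let ?M = "\<lambda>J. gc_monomial n e J" and ?e = "e (Suc n)"
  let ?L = "\<lambda>i. (K i + J i) mod m"
  obtain a where a: "?e ^ K (Suc n) * ?M J = a *s (?M J * ?e ^ K (Suc n))"
    using scalar_commute_power_left[OF generator_commute_monomial] Suc.prems
    by (metis Suc_le_eq lessI)
  obtain b where b: "?M K * ?M J = b *s ?M ?L" using Suc by auto
  have "?M K * ?e ^ K (Suc n) * (?M J * ?e ^ J (Suc n)) =
      ?M K * (?e ^ K (Suc n) * ?M J) * ?e ^ J (Suc n)"
    by (simp add: mult.assoc)
  also have "\<dots> = a *s ((?M K * ?M J) * (?e ^ K (Suc n) * ?e ^ J (Suc n)))"
    by (simp add: a scale_mult_left scale_mult_right mult.assoc)
  also have "\<dots> = (a * b) *s (?M ?L * ?e ^ ?L (Suc n))"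
    using generator_power_mod[of "Suc n"] Suc.prems
    by (simp add: b scale_mult_left power_add)
  finally show ?case unfolding gc_monomial_Suc ..
qed

text \<open>Multiplication by the monomial of \<open>K\<close> translates exponent tuples by
  \<open>K\<close> modulo \<open>m\<close>, and a nonzero translation has no fixed point.\<close>

lemma coeffs_monomial_mult:
  assumes K: "K \<in> gc_index m d" and J: "J \<in> gc_index m d"
  shows "cl_coeffs (gc_monomial d e K * gc_monomial d e J) J =
    (if K = (\<lambda>i\<in>{1..d}. 0) then 1 else 0)"
proof (cases "K = (\<lambda>i\<in>{1..d}. 0)")
  case True
  then show ?thesis
    using coeffs_scaled_monomial[OF J J, of 1] gc_monomial_0[of d e] by simp
next
  case False
  let ?L = "\<lambda>i\<in>{1..d}. (K i + J i) mod m"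
  have L: "?L \<in> gc_index m d" using m_pos by (auto simp: gc_index_def)
  obtain i where i: "i \<in> {1..d}" "K i \<noteq> 0"
  proof (rule ccontr)
    assume "\<not> thesis"
    then have "K = (\<lambda>i\<in>{1..d}. 0)" using that K
      by (auto simp: gc_index_def fun_eq_iff PiE_def extensional_def)
    then show False using False by simp
  qed
  have "(K i + J i) mod m \<noteq> J i"
  proof
    have lt: "K i < m" "J i < m" using K J i by (auto simp: gc_index_def)
    assume "(K i + J i) mod m = J i"
    then have "K i mod m = 0" using lt
      by (metis add.commute add_cancel_right_right diff_add_inverse mod_eq_dvd_iff_nat le_add1 mod_less dvd_imp_mod_0)
    then show False using lt i by simp
  qed
  then have ne: "J \<noteq> ?L" using i by (metis restrict_apply')
  obtain c where "gc_monomial d e K * gc_monomial d e J =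
      c *s gc_monomial d e (\<lambda>i. (K i + J i) mod m)"
    using monomial_mult by blast
  then have "gc_monomial d e K * gc_monomial d e J = c *s gc_monomial d e ?L"
    unfolding gc_monomial_restrict .
  then show ?thesis using coeffs_scaled_monomial[OF L J] ne False by simp
qed

lemma trace_monomial_basis:
  "(\<Sum>J\<in>gc_index m d. cl_coeffs (U * gc_monomial d e J) J) = of_nat (m ^ d) * gc_grade0 scale m d e U"
proof -
  have "cl_coeffs (U * gc_monomial d e J) J = gc_grade0 scale m d e U" if J: "J \<in> gc_index m d" for J
  proof -
    interpret J: module_hom scale "(*)" "\<lambda>U. cl_coeffs U J" by (rule coeffs_linear[OF J])
    have 0: "(\<lambda>i\<in>{1..d}. 0) \<in> gc_index m d" using m_pos by (auto simp: gc_index_def)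
    have "cl_coeffs (U * gc_monomial d e J) J =
        cl_coeffs ((\<Sum>K\<in>gc_index m d. cl_coeffs U K *s gc_monomial d e K) * gc_monomial d e J) J"
      by (simp flip: coeffs_expansion)
    also have "\<dots> = (\<Sum>K\<in>gc_index m d. cl_coeffs U K * cl_coeffs (gc_monomial d e K * gc_monomial d e J) J)"
      by (simp add: sum_distrib_right scale_mult_left J.sum J.scale)
    also have "\<dots> = (\<Sum>K\<in>gc_index m d. if K = (\<lambda>i\<in>{1..d}. 0) then cl_coeffs U K else 0)"
      by (rule sum.cong) (auto simp: coeffs_monomial_mult J)
    finally show ?thesis using 0 by (simp add: gc_grade0_def)
  qed
  then show ?thesis by (simp add: card_gc_index)
qed

end

section \<open>The trace in a minimal representation\<close>

text \<open>This treats both parities at once, with \<open>n\<close> the block size: a single block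
  for even \<open>d\<close>, \<open>m\<close> blocks for odd \<open>d\<close>. The product
  \<open>n * N\<close> counts the entries inside the blocks.\<close>

lemma gc_matrix_algebra_blocks:
  assumes m: "m \<ge> 1" and N: "N = m ^ ((d + 1) div 2)"
  obtains n where "n > 0" "n * N = m ^ d" "n dvd N"
    "gc_matrix_algebra m d =
       {M \<in> carrier_mat N N. \<forall>i<N. \<forall>j<N. i div n \<noteq> j div n \<longrightarrow> M $$ (i, j) = 0}"
proof (cases "even d")
  case True
  then have d: "(d + 1) div 2 = d div 2" by simp
  show ?thesis
  \<comment> \<open>With \<open>n = N\<close> all indices have quotient 0, so the vanishing
    condition is vacuous.\<close>
  proof (rule that[of N])
    have "N * N = m ^ (d div 2 + d div 2)" by (simp only: N d power_add)
    also have "d div 2 + d div 2 = d" using True by presburger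
    finally show "N * N = m ^ d" .
  qed (use m True in \<open>auto simp: N d gc_matrix_algebra_def\<close>)
next
  case False
  define n where "n = m ^ ((d - 1) div 2)"
  have Nn: "N = m * n" using False by (auto simp: N n_def elim!: oddE)
  have n: "n > 0" using m by (simp add: n_def)
  show ?thesis
  proof (rule that[of n])
    show "n * N = m ^ d"
      using False by (auto simp: Nn n_def mult_2 simp flip: power_Suc power_add elim!: oddE)
    have "gc_matrix_algebra m d =
        {M. \<exists>As. M = diag_block_mat As \<and> length As = m \<and> set As \<subseteq> carrier_mat n n}"
      using False by (simp add: gc_matrix_algebra_def n_def)
    also have "\<dots> =
        {M \<in> carrier_mat N N. \<forall>i<N. \<forall>j<N. i div n \<noteq> j div n \<longrightarrow> M $$ (i, j) = 0}"
      unfolding diag_block_mat_iff[OF n] Nn by blast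
    finally show "gc_matrix_algebra m d = \<dots>" .
  qed (use n in \<open>auto simp: Nn\<close>)
qed

text \<open>Since \<open>n dvd N\<close>, the last block is not cut off, so each block is a full
  interval of length \<open>n\<close>.\<close>

lemma card_block:
  assumes "n > 0" "n dvd N" "a < N"
  shows "card {b. b < N \<and> a div n = b div n} = (n::nat)"
proof -
  obtain k where N: "N = n * k" using assms by auto
  have "a div n < k" using assms by (simp add: N less_mult_imp_div_less mult.commute)
  then have le: "n * (a div n) + n \<le> N" unfolding N
    by (metis Suc_leI add.commute mult_Suc_right mult_le_mono2)
  have iff: "a div n = b div n \<longleftrightarrow> n * (a div n) \<le> b \<and> b < n * (a div n) + n" for b
  proof
    assume eq: "a div n = b div n"
    show "n * (a div n) \<le> b \<and> b < n * (a div n) + n"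
      unfolding eq using assms(1) mult_div_mod_eq[of n b] mod_less_divisor[of n b]
      by (intro conjI; linarith)
  next
    assume "n * (a div n) \<le> b \<and> b < n * (a div n) + n"
    then have "b div n = a div n" by (intro div_nat_eqI) (auto simp: mult.commute)
    then show "a div n = b div n" ..
  qed
  have "{b. b < N \<and> a div n = b div n} = {n * (a div n)..<n * (a div n) + n}"
    unfolding iff using le by auto
  then show ?thesis by simp
qed

context generalized_clifford_algebra
begin

text \<open>The second basis consists of the preimages \<open>c ab\<close> of the matrix units at
  the positions \<open>S\<close> inside the blocks. Finally the factor \<open>n\<close> is
  cancelled, using \<open>n * N = m ^ d\<close>.\<close>

lemma trace_minimal_rep:
  assumes rep: "gc_minimal_rep scale m d \<gamma>" and N: "N = m ^ ((d + 1) div 2)"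
  shows "(\<Sum>i<N. \<gamma> U $$ (i, i)) = of_nat N * gc_grade0 scale m d e U"
proof -
  obtain n where n: "n > 0" "n * N = m ^ d" "n dvd N" and alg: "gc_matrix_algebra m d =
      {M \<in> carrier_mat N N. \<forall>i<N. \<forall>j<N. i div n \<noteq> j div n \<longrightarrow> M $$ (i, j) = 0}"
    using gc_matrix_algebra_blocks[OF m_pos N] .
  from rep have bij: "bij_betw \<gamma> UNIV (gc_matrix_algebra m d)"
    and add: "\<And>x y. \<gamma> (x + y) = \<gamma> x + \<gamma> y"
    and scale: "\<And>c x. \<gamma> (c *s x) = c \<cdot>\<^sub>m \<gamma> x"
    and mult: "\<And>x y. \<gamma> (x * y) = \<gamma> x * \<gamma> y"
    unfolding gc_minimal_rep_def by auto
  have mem: "\<gamma> x \<in> gc_matrix_algebra m d" for x using bij by (auto simp: bij_betw_def)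
  have car: "\<gamma> x \<in> carrier_mat N N" for x using mem[of x] by (simp add: alg)
  have dims: "dim_row (\<gamma> x) = N" "dim_col (\<gamma> x) = N" for x using car[of x] by auto
  have off: "\<gamma> x $$ (i, j) = 0" if "i < N" "j < N" "i div n \<noteq> j div n" for x i j
    using mem[of x] that by (simp add: alg)
  define S where "S = (SIGMA a:{..<N}. {b. b < N \<and> a div n = b div n})"
  define E where "E = (\<lambda>ab. mat N N (\<lambda>ij. if ij = ab then 1 else 0 :: complex))"
  define c where "c = (\<lambda>ab. inv_into UNIV \<gamma> (E ab))"
  have S: "finite S" by (auto simp: S_def)
  have "E ab \<in> gc_matrix_algebra m d" if "ab \<in> S" for ab
    using that by (auto simp: alg E_def S_def)
  then have c: "\<gamma> (c ab) = E ab" if "ab \<in> S" for ab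
    using that bij by (simp add: c_def bij_betw_def f_inv_into_f)
  have lin: "module_hom scale (*) (\<lambda>x. \<gamma> x $$ ij)" if "ij \<in> {..<N} \<times> {..<N}" for ij
    using that by (intro linear_functionalI) (auto simp: add scale dims)
  have exp: "x = (\<Sum>ab\<in>S. \<gamma> x $$ ab *s c ab)" for x
  proof -
    have "\<gamma> x = \<gamma> (\<Sum>ab\<in>S. \<gamma> x $$ ab *s c ab)"
    proof (rule eq_matI)
      fix i j assume "i < dim_row (\<gamma> (\<Sum>ab\<in>S. \<gamma> x $$ ab *s c ab))"
        "j < dim_col (\<gamma> (\<Sum>ab\<in>S. \<gamma> x $$ ab *s c ab))"
      then have ij: "i < N" "j < N" by (auto simp: dims)
      interpret ij: module_hom scale "(*)" "\<lambda>x. \<gamma> x $$ (i, j)" by (rule lin) (use ij in auto)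
      have "\<gamma> (\<Sum>ab\<in>S. \<gamma> x $$ ab *s c ab) $$ (i, j) = (\<Sum>ab\<in>S. \<gamma> x $$ ab * E ab $$ (i, j))"
        by (simp add: ij.sum ij.scale c)
      also have "\<dots> = (\<Sum>ab\<in>S. if ab = (i, j) then \<gamma> x $$ (i, j) else 0)"
        by (rule sum.cong) (use ij in \<open>auto simp: E_def\<close>)
      \<comment> \<open>If \<open>(i, j)\<close> is outside the blocks, the sum is 0, and so is the
        entry by \<open>off\<close>.\<close>
      also have "\<dots> = \<gamma> x $$ (i, j)"
        using S ij off[of i j x] by (auto simp: S_def)
      finally show "\<gamma> x $$ (i, j) = \<gamma> (\<Sum>ab\<in>S. \<gamma> x $$ ab *s c ab) $$ (i, j)" ..
    qed (simp_all add: dims)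
    then show ?thesis using bij by (auto simp: bij_betw_def inj_def)
  qed
  have "of_nat n * (of_nat N * gc_grade0 scale m d e U) =
      (\<Sum>J\<in>gc_index m d. cl_coeffs (U * gc_monomial d e J) J)"
    by (simp add: trace_monomial_basis flip: n(2))
  also have "\<dots> = (\<Sum>ab\<in>S. \<gamma> (U * c ab) $$ ab)"
  proof (rule trace_basis_independent[where \<beta> = "\<lambda>J x. cl_coeffs x J" and b = "gc_monomial d e"
        and \<delta> = "\<lambda>ab x. \<gamma> x $$ ab" and f = "(*) U"])
    show "module_hom scale scale ((*) U)"
      by (simp add: module_hom_iff module_axioms distrib_left scale_mult_right)
    show "module_hom scale (*) (\<lambda>x. \<gamma> x $$ ab)" if "ab \<in> S" for ab
      by (rule lin) (use that in \<open>auto simp: S_def\<close>)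
  qed (fact finite_gc_index coeffs_expansion S exp | rule coeffs_linear, assumption)+
  also have "\<dots> = (\<Sum>(a, b)\<in>S. \<gamma> U $$ (a, a))"
  proof (rule sum.cong[OF refl], clarify)
    fix a b assume ab: "(a, b) \<in> S"
    then have lt: "a < N" "b < N" by (auto simp: S_def)
    \<comment> \<open>Right multiplication by the unit at \<open>(a, b)\<close> moves column
      \<open>a\<close> to column \<open>b\<close>. The result does not depend on \<open>b\<close>,
      so each diagonal entry is counted \<open>n\<close> times.\<close>
    have "(\<gamma> U * E (a, b)) $$ (a, b) = (\<Sum>k = 0..<N. \<gamma> U $$ (a, k) * (if k = a then 1 else 0))"
      using lt by (simp add: E_def scalar_prod_def dims)
    also have "\<dots> = \<gamma> U $$ (a, a)" using lt by (simp add: if_distrib[of "\<lambda>x. _ * x"] cong: if_cong)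
    finally show "\<gamma> (U * c (a, b)) $$ (a, b) = \<gamma> U $$ (a, a)"
      by (simp only: mult c[OF ab])
  qed
  also have "\<dots> = (\<Sum>a<N. \<Sum>b | b < N \<and> a div n = b div n. \<gamma> U $$ (a, a))"
    unfolding S_def by (rule sum.Sigma[symmetric]) auto
  also have "\<dots> = of_nat n * (\<Sum>a<N. \<gamma> U $$ (a, a))"
    by (simp add: card_block n sum_distrib_left)
  finally show ?thesis using n by simp
qed

end

section \<open>Reading off the characteristic coefficients\<close>

lemma poly_monic_expansion:
  assumes "degree p = N" "coeff p N = (1 :: 'a::comm_ring_1)"
  shows "poly p t = t ^ N - (\<Sum>k=1..N. - coeff p (N - k) * t ^ (N - k))"
proof -
  have "(\<Sum>k=1..N. - coeff p (N - k) * t ^ (N - k)) = (\<Sum>i<N. - coeff p i * t ^ i)"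
    by (rule sum.reindex_bij_witness[of _ "\<lambda>i. N - i" "\<lambda>k. N - k"]) auto
  then show ?thesis using assms
    by (simp add: poly_altdef sum_negf lessThan_Suc_atMost[symmetric])
qed

text \<open>The description is well defined because a complex polynomial is determined by its
  values.\<close>

lemma char_coeffs_eq:
  assumes "degree p = N" "coeff p N = 1" "\<And>t. \<phi> t = poly p t"
  shows "char_coeffs N \<phi> = (\<lambda>k\<in>{1..N}. - coeff p (N - k))"
  unfolding char_coeffs_def
proof (rule the_equality)
  show "(\<lambda>k\<in>{1..N}. - coeff p (N - k)) \<in> {1..N} \<rightarrow>\<^sub>E UNIV \<and>
      (\<forall>t. \<phi> t = t ^ N - (\<Sum>k=1..N. (\<lambda>k\<in>{1..N}. - coeff p (N - k)) k * t ^ (N - k)))"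
    using poly_monic_expansion[OF assms(1,2)] by (auto simp: assms(3) intro!: sum.cong)
next
  fix C assume C: "C \<in> {1..N} \<rightarrow>\<^sub>E UNIV \<and> (\<forall>t. \<phi> t = t ^ N - (\<Sum>k=1..N. C k * t ^ (N - k)))"
  define q where "q = monom 1 N - (\<Sum>k=1..N. monom (C k) (N - k))"
  have "poly p t = poly q t" for t
    using C assms(3)[of t] by (simp add: q_def poly_sum poly_monom)
  then have "p = q" by (simp add: poly_eq_poly_eq_iff[symmetric] fun_eq_iff)
  have "C k = - coeff p (N - k)" if k: "k \<in> {1..N}" for k
  proof -
    have "(\<Sum>l=1..N. coeff (monom (C l) (N - l)) (N - k)) = (\<Sum>l=1..N. if l = k then C k else 0)"
      by (rule sum.cong) (use k in auto)
    \<comment> \<open>The leading term of \<open>q\<close> therefore does not contribute to the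
      coefficient at \<open>N - k\<close>.\<close>
    moreover have "N \<noteq> N - k" using k by auto
    ultimately show ?thesis using k by (simp add: \<open>p = q\<close> q_def coeff_sum)
  qed
  then show "C = (\<lambda>k\<in>{1..N}. - coeff p (N - k))"
    using C by (auto simp: fun_eq_iff PiE_def extensional_def)
qed

section \<open>The recursion and the determinant\<close>

theorem theorem7p5:
  fixes scale :: "complex \<Rightarrow> 'a::ring_1 \<Rightarrow> 'a"
    and m d N :: nat
    and e :: "nat \<Rightarrow> 'a"
    and \<gamma> :: "'a \<Rightarrow> complex mat"
    and U :: 'a
    and C :: "nat \<Rightarrow> complex"
    and V :: "nat \<Rightarrow> 'a"
  assumes "generalized_clifford_algebra scale m d e"
    and "gc_minimal_rep scale m d \<gamma>"
    and "N = m ^ ((d + 1) div 2)"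
    and "C = char_coeffs N (gc_char_poly scale \<gamma> U)"
    and "V 1 = U"
    and "\<And>k. 1 \<le> k \<Longrightarrow> k < N \<Longrightarrow> V (k + 1) = U * (V k - scale (C k) 1)"
  shows "(\<forall>t. gc_char_poly scale \<gamma> U t = t ^ N - (\<Sum>k=1..N. C k * t ^ (N - k))) \<and>
         (\<forall>k\<in>{1..N}. C k = of_nat N / of_nat k * gc_grade0 scale m d e (V k)) \<and>
         scale (gc_Det \<gamma> U) 1 = (-1) ^ N * (- V N) \<and>
         - V N = - scale (C N) 1 \<and>
         (N \<ge> 2 \<longrightarrow> - V N = U * (scale (C (N - 1)) 1 - V (N - 1)))"
proof -
  interpret generalized_clifford_algebra scale m d e by (rule assms)
  note N = assms(3) and V1 = assms(5) and VS = assms(6)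
  have N0: "N > 0" using m_pos by (simp add: N)
  from assms(2) have bij: "bij_betw \<gamma> UNIV (gc_matrix_algebra m d)"
    and add: "\<And>x y. \<gamma> (x + y) = \<gamma> x + \<gamma> y"
    and scale: "\<And>c x. \<gamma> (scale c x) = c \<cdot>\<^sub>m \<gamma> x"
    and mult: "\<And>x y. \<gamma> (x * y) = \<gamma> x * \<gamma> y"
    and one: "\<gamma> 1 = 1\<^sub>m N"
    unfolding gc_minimal_rep_def N by auto
  obtain n where alg: "gc_matrix_algebra m d =
      {M \<in> carrier_mat N N. \<forall>i<N. \<forall>j<N. i div n \<noteq> j div n \<longrightarrow> M $$ (i, j) = 0}"
    using gc_matrix_algebra_blocks[OF m_pos N] .
  have car: "\<gamma> x \<in> carrier_mat N N" for x using bij alg by (auto simp: bij_betw_def)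
  have dims [simp]: "dim_row (\<gamma> x) = N" "dim_col (\<gamma> x) = N" for x using car[of x] by auto
  have diff: "\<gamma> (x - y) = \<gamma> x - \<gamma> y" for x y
  proof -
    have "\<gamma> (x - y) = \<gamma> x + (-1) \<cdot>\<^sub>m \<gamma> y" by (simp flip: add scale)
    also have "\<dots> = \<gamma> x - \<gamma> y" by (auto intro!: eq_matI)
    finally show ?thesis .
  qed

  define A where "A = \<gamma> U"
  have A: "A \<in> carrier_mat N N" by (simp add: A_def car)
  have dimA [simp]: "dim_row A = N" "dim_col A = N" by (simp_all add: A_def)
  let ?p = "char_poly A"
  let ?M = "adj_coeff_mat A"
  note M = adj_coeff_mat_carrier[OF A]
  have phi: "gc_char_poly scale \<gamma> U t = poly ?p t" for t
    by (simp add: gc_char_poly_def gc_Det_def diff scale one poly_char_poly[OF A] flip: A_def)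
  have C: "C = (\<lambda>k\<in>{1..N}. - coeff ?p (N - k))"
    unfolding assms(4) using degree_monic_char_poly[OF A] phi by (intro char_coeffs_eq) auto
  have Ck: "C k = - coeff ?p (N - k)" if "1 \<le> k" "k \<le> N" for k using that by (simp add: C)

  \<comment> \<open>Subtracting \<open>C k\<close> from \<open>A * ?M (N - k)\<close> gives
    \<open>?M (N - Suc k)\<close> by the adjugate recursion, and multiplying by \<open>U\<close>
    restores the factor \<open>A\<close>.\<close>
  have V: "\<gamma> (V k) = A * ?M (N - k)" if "1 \<le> k" "k \<le> N" for k
    using that
  proof (induction k rule: nat_induct_at_least)
    case base
    show ?case using adj_coeff_mat_top[OF A N0] A V1 by (simp add: A_def)
  next
    case (Suc k)
    have k: "Suc (N - Suc k) = N - k" using Suc by simp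
    have "\<gamma> (V k) - C k \<cdot>\<^sub>m 1\<^sub>m N = A * ?M (N - k) + coeff ?p (N - k) \<cdot>\<^sub>m 1\<^sub>m N"
      using Suc A M by (auto simp: Ck intro!: eq_matI)
    also have "\<dots> = ?M (N - Suc k)"
      using adj_coeff_mat_Suc[OF A, of "N - Suc k"] by (simp only: k)
    finally show ?case using Suc VS[of k] by (simp add: mult diff scale one A_def)
  qed

  \<comment> \<open>At \<open>k = N\<close> the constant term of the adjugate identity gives the
    image of \<open>V N\<close>; injectivity of \<gamma> brings the equation back to the
    algebra.\<close>
  have VN: "V N = scale (C N) 1"
  proof -
    have "\<gamma> (V N) = \<gamma> (scale (C N) 1)"
    proof (rule eq_matI)
      fix i j assume "i < dim_row (\<gamma> (scale (C N) 1))" "j < dim_col (\<gamma> (scale (C N) 1))"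
      then have ij: "i < N" "j < N" by auto
      then show "\<gamma> (V N) $$ (i, j) = \<gamma> (scale (C N) 1) $$ (i, j)"
        using N0 V[of N] arg_cong[OF adj_coeff_mat_0[OF A], of "\<lambda>X. X $$ (i, j)"]
        unfolding scale one
        by (simp add: Ck eq_neg_iff_add_eq_0 del: index_mult_mat(1) split: if_splits)
    qed simp_all
    then show ?thesis using bij by (auto simp: bij_betw_def inj_def)
  qed

  \<comment> \<open>For \<open>k < N\<close> the image of \<open>V k\<close> is
    \<open>?M (N - Suc k)\<close> plus \<open>C k\<close>, with trace -(N - k) C_k + N C_k = k C_k.
    The case \<open>k = N\<close> is separate because of truncated subtraction; there
    \<open>V N\<close> is a scalar.\<close>
  have trace: "of_nat N * gc_grade0 scale m d e (V k) = of_nat k * C k"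
    if k: "1 \<le> k" "k \<le> N" for k
  proof (cases "k = N")
    case True
    show ?thesis
      unfolding True trace_minimal_rep[OF assms(2) N, symmetric] by (simp add: VN scale one)
  next
    case False
    then have Suc: "Suc (N - Suc k) = N - k" using k by simp
    have "\<gamma> (V k) $$ (i, i) = ?M (N - Suc k) $$ (i, i) - coeff ?p (N - k)" if "i < N" for i
      using adj_coeff_mat_Suc[OF A, of "N - Suc k"] V[OF k] that
      by (simp add: Suc del: index_mult_mat(1))
    then have "(\<Sum>i<N. \<gamma> (V k) $$ (i, i)) =
        of_nat (N - k) * coeff ?p (N - k) - of_nat N * coeff ?p (N - k)"
      using trace_adj_coeff_mat[OF A, of "N - Suc k"] by (simp add: sum_subtractf Suc del: of_nat_Suc)
    then show ?thesis using trace_minimal_rep[OF assms(2) N, of "V k"] k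
      by (simp add: Ck of_nat_diff algebra_simps)
  qed

  \<comment> \<open>The sign comes from p(0) = det(-A) = (-1)^N det(A).\<close>
  have "gc_Det \<gamma> U = (-1) ^ N * poly ?p 0"
  proof -
    have "0 \<cdot>\<^sub>m 1\<^sub>m N - A = (-1) \<cdot>\<^sub>m A" using A by (intro eq_matI) auto
    then have "poly ?p 0 = (-1) ^ N * det A"
      by (simp add: poly_char_poly[OF A])
    then show ?thesis by (simp add: gc_Det_def A_def flip: power_mult_distrib mult.assoc)
  qed
  also have "poly ?p 0 = - C N" using N0 by (simp add: Ck poly_0_coeff_0)
  finally have "scale (gc_Det \<gamma> U) 1 = (-1) ^ N * (- V N)"
    unfolding VN by (cases "even N") auto
  moreover have "\<forall>t. gc_char_poly scale \<gamma> U t = t ^ N - (\<Sum>k=1..N. C k * t ^ (N - k))"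
  proof -
    have "poly ?p t = t ^ N - (\<Sum>k=1..N. C k * t ^ (N - k))" for t
      using poly_monic_expansion[of ?p N t] degree_monic_char_poly[OF A]
      by (auto simp: C intro!: sum.cong)
    then show ?thesis by (simp add: phi)
  qed
  moreover have "C k = of_nat N / of_nat k * gc_grade0 scale m d e (V k)" if "k \<in> {1..N}" for k
    using trace[of k] that by (simp add: field_simps)
  \<comment> \<open>The recursion is applied at index \<open>N - 1\<close>, which is at least 1
    precisely when \<open>N \<ge> 2\<close>.\<close>
  moreover have "- V N = U * (scale (C (N - 1)) 1 - V (N - 1))" if "N \<ge> 2"
  proof -
    have "V N = U * (V (N - 1) - scale (C (N - 1)) 1)" using VS[of "N - 1"] that by simp
    then show ?thesis by (simp add: right_diff_distrib)
  qed
  ultimately show ?thesis using arg_cong[OF VN, of uminus] by blast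
qed

end
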